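(* Consider a market with a finite list of $m$ possible assets and a set $\mathcal X\subset[0,\infty)^m$ of $k\ge 3$ distinct feasible price relative vectors. Assume that the Bregman divergence $$(P,Q)\mapsto W(\vec b_P,P)-W(\vec b_Q,P)$$ satisfies the sufficiency condition for probability measures $P$ and $Q$ supported on $\mathcal X$. Then the set of possible assets contains $k$ gambling assets, and any other asset is dominated by a portfolio on the gambling assets.
   Context: A price relative vector $\vec X=(X_1,\dots,X_m)$ lists, for each of $m$ assets, the nonnegative factor by which the value of the asset is multiplied in one trading period. A portfolio is a probability vector $\vec b=(b_1,\dots,b_m)$; asset $i$ is identified with the basis vector $\vec e_i$. A portfolio $\vec b_1$ dominates $\vec b_2$ if $\langle\vec X,\vec b_1\rangle\ge\langle\vec X,\vec b_2\rangle$ for every $\vec X\in\mathcal X$. A gambling asset is an asset whose price relative is positive for only one of the feasible price relative vectors. For a probability measure $P$ on $\mathcal X$ let $W(\vec b,P)=E_P[\log\langle\vec X,\vec b\rangle]\in[-\infty,\infty)$, with $\log 0=-\infty$ and $0\cdot(-\infty)=0$. Let $\vec b_P$ denote a portfolio maximizing $W(\cdot,P)$. The quantity $W(\vec b_P,P)-W(\vec b_Q,P)$ is the regret of using a portfolio optimal for $Q$ when the distribution is $P$; if $\vec b_Q$ is not uniquely determined, the minimum over all portfolios $\vec b$ optimal for $Q$ is taken. The maximal values $W(\vec b_P,P)$ are taken to be finite, so that the regret is defined. Sufficiency condition. Let $S$ be the simplex of probability measures on $\mathcal X$. An isometry of $S$ is an affine bijection $S\to S$. An isomixture is a convex combination $\Phi=\sum_i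 p_i\Phi_i$ of isometries. An affine map $\Phi:S\to S$ is sufficient for $(P,Q)$ if there is an affine map $\Psi:S\to S$ with $\Psi(\Phi(P))=P$ and $\Psi(\Phi(Q))=Q$. A divergence $D(\cdot,\cdot)$ on $S$ satisfies the sufficiency condition (iso-sufficiency) if $D(\Phi(P),\Phi(Q))=D(P,Q)$ for all $P,Q\in S$ and every isomixture $\Phi:S\to S$ that is sufficient for $(P,Q)$.
   Formalization: The formal theorem also assumes that the regret is not identically zero; without this the claim fails, e.g. for a single asset with feasible price relatives 1, 2, 3, where the regret vanishes and no gambling asset exists. *)

theory Defs
  imports "HOL-Probability.Probability"
begin

text \<open>
  A probability measure on a finite set \<open>X\<close> is a \<^typ>\<open>'a pmf\<close> supported in \<open>X\<close>; convex
  combinations of such measures are expressed pointwise on their mass functions.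
\<close>

definition prob_simplex :: "'a set \<Rightarrow> 'a pmf set" where
  "prob_simplex X = {P. set_pmf P \<subseteq> X}"

definition affine_map :: "'a set \<Rightarrow> ('a pmf \<Rightarrow> 'a pmf) \<Rightarrow> bool" where
  "affine_map X \<Phi> \<longleftrightarrow>
     \<Phi> ` prob_simplex X \<subseteq> prob_simplex X \<and>
     (\<forall>P\<in>prob_simplex X. \<forall>Q\<in>prob_simplex X. \<forall>R\<in>prob_simplex X. \<forall>t\<in>{0..1::real}.
        (\<forall>x. pmf R x = (1 - t) * pmf P x + t * pmf Q x) \<longrightarrow>
        (\<forall>x. pmf (\<Phi> R) x = (1 - t) * pmf (\<Phi> P) x + t * pmf (\<Phi> Q) x))"

definition isometry :: "'a set \<Rightarrow> ('a pmf \<Rightarrow> 'a pmf) \<Rightarrow> bool" where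
  "isometry X \<Phi> \<longleftrightarrow> affine_map X \<Phi> \<and> bij_betw \<Phi> (prob_simplex X) (prob_simplex X)"

definition isomixture :: "'a set \<Rightarrow> ('a pmf \<Rightarrow> 'a pmf) \<Rightarrow> bool" where
  "isomixture X \<Phi> \<longleftrightarrow>
     (\<exists>(n::nat) (p :: nat \<Rightarrow> real) (\<phi> :: nat \<Rightarrow> 'a pmf \<Rightarrow> 'a pmf).
        (\<forall>i<n. 0 \<le> p i) \<and> (\<Sum>i<n. p i) = 1 \<and> (\<forall>i<n. isometry X (\<phi> i)) \<and>
        (\<forall>P\<in>prob_simplex X. \<forall>x. pmf (\<Phi> P) x = (\<Sum>i<n. p i * pmf (\<phi> i P) x)))"

definition sufficient :: "'a set \<Rightarrow> ('a pmf \<Rightarrow> 'a pmf) \<Rightarrow> 'a pmf \<Rightarrow> 'a pmf \<Rightarrow> bool" where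
  "sufficient X \<Phi> P Q \<longleftrightarrow>
     affine_map X \<Phi> \<and> (\<exists>\<Psi>. affine_map X \<Psi> \<and> \<Psi> (\<Phi> P) = P \<and> \<Psi> (\<Phi> Q) = Q)"

definition sufficiency_condition :: "'a set \<Rightarrow> ('a pmf \<Rightarrow> 'a pmf \<Rightarrow> ereal) \<Rightarrow> bool" where
  "sufficiency_condition X D \<longleftrightarrow>
     (\<forall>P\<in>prob_simplex X. \<forall>Q\<in>prob_simplex X. \<forall>\<Phi>.
        isomixture X \<Phi> \<and> sufficient X \<Phi> P Q \<longrightarrow> D (\<Phi> P) (\<Phi> Q) = D P Q)"

text \<open>
  Assets are the elements of a finite type \<open>'m\<close>; a price relative vector and a portfolio are
  both vectors in \<^typ>\<open>real ^ 'm\<close>, and the asset \<open>i\<close> is the portfolio \<open>axis i 1\<close>.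
\<close>

definition portfolio :: "real ^ 'm::finite \<Rightarrow> bool" where
  "portfolio b \<longleftrightarrow> (\<forall>i. 0 \<le> b $ i) \<and> (\<Sum>i\<in>UNIV. b $ i) = 1"

definition dominates :: "(real ^ 'm::finite) set \<Rightarrow> real ^ 'm \<Rightarrow> real ^ 'm \<Rightarrow> bool" where
  "dominates X b\<^sub>1 b\<^sub>2 \<longleftrightarrow> (\<forall>x\<in>X. x \<bullet> b\<^sub>2 \<le> x \<bullet> b\<^sub>1)"

definition gambling_asset :: "(real ^ 'm::finite) set \<Rightarrow> 'm \<Rightarrow> bool" where
  "gambling_asset X i \<longleftrightarrow> (\<exists>!x. x \<in> X \<and> 0 < x $ i)"

text \<open>The logarithm on the nonnegative reals with value minus infinity at zero.\<close>

definition elog :: "real \<Rightarrow> ereal" where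
  "elog y = (if y = 0 then - \<infinity> else ereal (ln y))"

text \<open>
  \<open>growth_rate X b P\<close> is the expectation of the logarithmic return, with values in
  \<^typ>\<open>ereal\<close>, where zero times minus infinity is zero.
\<close>

definition growth_rate :: "(real ^ 'm::finite) set \<Rightarrow> real ^ 'm \<Rightarrow> (real ^ 'm) pmf \<Rightarrow> ereal" where
  "growth_rate X b P = (\<Sum>x\<in>X. ereal (pmf P x) * elog (x \<bullet> b))"

definition optimal_portfolio :: "(real ^ 'm::finite) set \<Rightarrow> (real ^ 'm) pmf \<Rightarrow> real ^ 'm \<Rightarrow> bool" where
  "optimal_portfolio X P b \<longleftrightarrow>
     portfolio b \<and> (\<forall>b'. portfolio b' \<longrightarrow> growth_rate X b' P \<le> growth_rate X b P)"

text \<open>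
  The supremum in \<open>max_growth_rate\<close> and, when the maximal values are finite, the infimum in
  \<open>regret\<close> are attained, because the growth rate is upper semicontinuous in the portfolio and
  the set of portfolios is compact.
\<close>

definition max_growth_rate :: "(real ^ 'm::finite) set \<Rightarrow> (real ^ 'm) pmf \<Rightarrow> ereal" where
  "max_growth_rate X P = (SUP b\<in>{b. portfolio b}. growth_rate X b P)"

definition regret :: "(real ^ 'm::finite) set \<Rightarrow> (real ^ 'm) pmf \<Rightarrow> (real ^ 'm) pmf \<Rightarrow> ereal" where
  "regret X P Q =
     (INF b\<in>{b. optimal_portfolio X Q b}. max_growth_rate X P - growth_rate X b P)"

end

theory Submission
  imports Defs
begin

text \<open>
  Merging outcomes of equal likelihood ratio, and permuting outcomes, is reversible. The first fact
  applied to a point mass \<open>P\<close> at \<open>x\<close> shows that the logarithmic return of an optimal portfolio for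
  \<open>Q\<close> on \<open>x\<close> is \<open>a\<^sub>x - h (Q x)\<close> with one function \<open>h\<close>; applied to three outcomes it gives a
  functional equation whose only solutions that vanish at 1 and are bounded on \<open>[1/2, 1]\<close> are
  \<open>h = - c ln\<close>. So the maximal growth rate is \<open>c\<close> times the negative entropy plus an affine
  function, and \<open>c > 0\<close> because the regret does not vanish identically.

  The infinite slope of the entropy at a vertex \<open>x\<close> forces the assets with the top return on \<open>x\<close> to
  return nothing elsewhere, which yields the gambling assets. Comparing slopes at a vertex of the
  polytope of returns gives \<open>c \<ge> 1\<close>. If the returns of an asset relative to the gambling assets had a
  sum greater than 1, the asset would then beat the maximal growth rate at the normalized relative
  returns.
\<close>

section \<open>Reversible mixtures of permutations\<close>

text \<open>A convex combination of two laws is a bind over a coin with bias \<open>t\<close>.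
  Affineness then becomes commutation with this bind, which the monad laws settle for maps of the
  form \<open>bind_pmf P K\<close>.\<close>

lemma affine_mapI:
  fixes X :: "'a set"
  assumes "\<And>P. P \<in> prob_simplex X \<Longrightarrow> \<Phi> P \<in> prob_simplex X"
    and bind: "\<And>P Q t. 0 \<le> t \<Longrightarrow> t \<le> 1 \<Longrightarrow>
      \<Phi> (bind_pmf (bernoulli_pmf t) (\<lambda>b. if b then Q else P)) =
      bind_pmf (bernoulli_pmf t) (\<lambda>b. if b then \<Phi> Q else \<Phi> P)"
  shows "affine_map X \<Phi>"
  unfolding affine_map_def
proof (intro conjI ballI impI allI)
  show "\<Phi> ` prob_simplex X \<subseteq> prob_simplex X" using assms(1) by blast
next
  fix P Q R :: "'a pmf" and x :: 'a and t :: real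
  assume t: "t \<in> {0..1}" and R: "\<forall>x. pmf R x = (1 - t) * pmf P x + t * pmf Q x"
  have "R = bind_pmf (bernoulli_pmf t) (\<lambda>b. if b then Q else P)"
    using t R by (intro pmf_eqI) (simp add: pmf_bind)
  then show "pmf (\<Phi> R) x = (1 - t) * pmf (\<Phi> P) x + t * pmf (\<Phi> Q) x"
    using t by (simp add: bind pmf_bind)
qed

lemma affine_map_bind_pmf:
  assumes "\<And>x. x \<in> X \<Longrightarrow> set_pmf (K x) \<subseteq> X"
  shows "affine_map X (\<lambda>P. bind_pmf P K)"
proof (rule affine_mapI)
  show "bind_pmf P K \<in> prob_simplex X" if "P \<in> prob_simplex X" for P
    using assms that by (auto simp: prob_simplex_def)
qed (auto simp: bind_assoc_pmf intro!: bind_pmf_cong)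

lemma affine_map_map_pmf: "f ` X \<subseteq> X \<Longrightarrow> affine_map X (map_pmf f)"
  unfolding map_pmf_def by (intro affine_map_bind_pmf) auto

lemma isometry_map_pmf:
  assumes \<sigma>: "\<sigma> permutes X"
  shows "isometry X (map_pmf \<sigma>)"
  unfolding isometry_def
proof
  show "affine_map X (map_pmf \<sigma>)"
    using permutes_image[OF \<sigma>] by (intro affine_map_map_pmf) auto
  show "bij_betw (map_pmf \<sigma>) (prob_simplex X) (prob_simplex X)"
  proof (rule bij_betw_byWitness[where f' = "map_pmf (inv \<sigma>)"])
    show "map_pmf \<sigma> ` prob_simplex X \<subseteq> prob_simplex X"
      using permutes_in_image[OF \<sigma>] by (fastforce simp: prob_simplex_def)
    show "map_pmf (inv \<sigma>) ` prob_simplex X \<subseteq> prob_simplex X"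
      using permutes_in_image[OF permutes_inv[OF \<sigma>]] by (fastforce simp: prob_simplex_def)
  qed (auto simp: pmf.map_comp permutes_inv_o[OF \<sigma>])
qed

text \<open>Drawing a permutation from \<open>M\<close> and then applying it is the convex
  combination with weights \<open>pmf M i\<close>. The enumeration \<open>e\<close> of the support
  turns the draw into a sum over an initial segment of the naturals.\<close>

lemma isomixture_bind_pmf:
  assumes M: "finite (set_pmf M)" and \<sigma>: "\<And>i. i \<in> set_pmf M \<Longrightarrow> \<sigma> i permutes X"
  shows "isomixture X (\<lambda>P. bind_pmf M (\<lambda>i. map_pmf (\<sigma> i) P))"
proof -
  obtain e where e: "bij_betw e {0..<card (set_pmf M)} (set_pmf M)"
    using ex_bij_betw_nat_finite[OF M] by blast
  let ?n = "card (set_pmf M)"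
  have reindex: "(\<Sum>i<?n. g (e i)) = (\<Sum>a\<in>set_pmf M. g a)" for g :: "_ \<Rightarrow> real"
    using sum.reindex_bij_betw[OF e, of g] by (simp add: atLeast0LessThan)
  show ?thesis
    unfolding isomixture_def
  proof (intro exI conjI)
    show "\<forall>i<?n. 0 \<le> pmf M (e i)" by simp
    show "(\<Sum>i<?n. pmf M (e i)) = 1"
      using reindex[of "pmf M"] sum_pmf_eq_1[OF M] by simp
    show "\<forall>i<?n. isometry X (map_pmf (\<sigma> (e i)))"
      using bij_betwE[OF e] \<sigma> by (auto intro!: isometry_map_pmf)
    show "\<forall>P\<in>prob_simplex X. \<forall>x. pmf (bind_pmf M (\<lambda>i. map_pmf (\<sigma> i) P)) x =
        (\<Sum>i<?n. pmf M (e i) * pmf (map_pmf (\<sigma> (e i)) P) x)"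
    proof (intro ballI allI)
      fix P x
      show "pmf (bind_pmf M (\<lambda>i. map_pmf (\<sigma> i) P)) x =
        (\<Sum>i<?n. pmf M (e i) * pmf (map_pmf (\<sigma> (e i)) P) x)"
        using reindex[of "\<lambda>a. pmf M a * pmf (map_pmf (\<sigma> a) P) x"]
        by (simp add: pmf_bind integral_measure_pmf[OF M])
    qed
  qed
qed

text \<open>If one map \<open>f\<close> undoes every drawn permutation on the two supports, then
  \<open>map_pmf f\<close> recovers both laws whatever was drawn. It is therefore a witness of
  sufficiency.\<close>

lemma sufficiency_condition_bind_pmf:
  assumes D: "sufficiency_condition X D" and PQ: "P \<in> prob_simplex X" "Q \<in> prob_simplex X"
    and M: "finite (set_pmf M)" and \<sigma>: "\<And>i. i \<in> set_pmf M \<Longrightarrow> \<sigma> i permutes X"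
    and f: "f ` X \<subseteq> X"
    and inv: "\<And>i w. i \<in> set_pmf M \<Longrightarrow> w \<in> set_pmf P \<union> set_pmf Q \<Longrightarrow> f (\<sigma> i w) = w"
  shows "D (bind_pmf M (\<lambda>i. map_pmf (\<sigma> i) P)) (bind_pmf M (\<lambda>i. map_pmf (\<sigma> i) Q)) = D P Q"
proof -
  let ?\<Phi> = "\<lambda>P. bind_pmf M (\<lambda>i. map_pmf (\<sigma> i) P)"
  have "affine_map X ?\<Phi>"
  proof -
    have "?\<Phi> = (\<lambda>P. bind_pmf P (\<lambda>x. map_pmf (\<lambda>i. \<sigma> i x) M))"
      unfolding map_pmf_def by (intro ext bind_commute_pmf)
    moreover have "\<sigma> i x \<in> X" if "i \<in> set_pmf M" "x \<in> X" for i x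
      using that permutes_in_image[OF \<sigma>] by simp
    ultimately show ?thesis by (auto intro!: affine_map_bind_pmf)
  qed
  moreover have "map_pmf f (?\<Phi> R) = R" if "set_pmf R \<subseteq> set_pmf P \<union> set_pmf Q" for R
  proof -
    have "map_pmf f (?\<Phi> R) = bind_pmf M (\<lambda>i. map_pmf (\<lambda>w. f (\<sigma> i w)) R)"
      by (simp add: map_bind_pmf pmf.map_comp o_def)
    also have "\<dots> = bind_pmf M (\<lambda>i. R)"
      using that inv by (intro bind_pmf_cong refl) (auto intro!: map_pmf_idI)
    finally show ?thesis by simp
  qed
  ultimately have "sufficient X ?\<Phi> P Q"
    unfolding sufficient_def using affine_map_map_pmf[OF f] by blast
  then show ?thesis
    using D PQ isomixture_bind_pmf[of M \<sigma>, OF M \<sigma>] unfolding sufficiency_condition_def by blast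
qed

section \<open>Laws on two points\<close>

lemma pmf_eq_1_return: "pmf Q x = 1 \<Longrightarrow> Q = return_pmf x"
proof -
  assume q: "pmf Q x = 1"
  have "set_pmf Q \<subseteq> {x}"
  proof
    fix v assume v: "v \<in> set_pmf Q"
    have "pmf Q v + pmf Q x \<le> 1" if "v \<noteq> x"
      using that measure_pmf.prob_le_1[of Q "{v, x}"] by (simp add: measure_measure_pmf_finite)
    then show "v \<in> {x}" using q pmf_positive[OF v] by force
  qed
  then show ?thesis by (simp add: set_pmf_subset_singleton)
qed

definition two_point_pmf :: "'a \<Rightarrow> 'a \<Rightarrow> real \<Rightarrow> 'a pmf" where
  "two_point_pmf x y q = map_pmf (\<lambda>b. if b then x else y) (bernoulli_pmf q)"

lemma set_two_point_pmf: "set_pmf (two_point_pmf x y q) \<subseteq> {x, y}"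
  by (auto simp: two_point_pmf_def)

lemma two_point_pmf_1 [simp]: "two_point_pmf x y 1 = return_pmf x"
  using pmf_eq_1_return[of "bernoulli_pmf 1" True] by (simp add: two_point_pmf_def)

lemma pmf_two_point_pmf:
  assumes "0 \<le> q" "q \<le> 1"
  shows "pmf (two_point_pmf x y q) v = q * of_bool (v = x) + (1 - q) * of_bool (v = y)"
  using assms by (simp add: two_point_pmf_def map_pmf_def pmf_bind indicator_def)

lemma two_point_in_simplex: "x \<in> X \<Longrightarrow> y \<in> X \<Longrightarrow> two_point_pmf x y q \<in> prob_simplex X"
  using set_two_point_pmf[of x y q] by (auto simp: prob_simplex_def)

lemma sum_two_point_pmf:
  fixes f :: "'a \<Rightarrow> real"
  assumes "finite X" "x \<in> X" "y \<in> X" "x \<noteq> y" "0 \<le> q" "q \<le> 1"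
  shows "(\<Sum>v\<in>X. pmf (two_point_pmf x y q) v * f v) = q * f x + (1 - q) * f y"
proof -
  have "(\<Sum>v\<in>X. pmf (two_point_pmf x y q) v * f v) = (\<Sum>v\<in>{x, y}. pmf (two_point_pmf x y q) v * f v)"
    using assms by (intro sum.mono_neutral_right) (auto simp: pmf_two_point_pmf)
  then show ?thesis using assms by (simp add: pmf_two_point_pmf)
qed

lemma map_two_point_pmf: "map_pmf f (two_point_pmf x y q) = two_point_pmf (f x) (f y) q"
  by (simp add: two_point_pmf_def pmf.map_comp o_def if_distrib)

text \<open>\<open>M\<close> is \<open>Q\<close> conditioned on avoiding \<open>x\<close>. If
  \<open>Q\<close> is the point mass at \<open>x\<close>, conditioning is impossible; the second
  point of the pair then has weight 0 and the spare point \<open>w\<close> serves for it.\<close>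

lemma pmf_decompose_at:
  assumes x: "pmf Q x = q" "w \<noteq> x"
  obtains M where "set_pmf M \<subseteq> insert w (set_pmf Q) - {x}"
    and "Q = bind_pmf M (\<lambda>w. two_point_pmf x w q)"
proof (cases "q = 1")
  case True
  have "Q = return_pmf x" using x True by (simp add: pmf_eq_1_return)
  then show ?thesis using x True by (intro that[of "return_pmf w"]) (auto simp: bind_return_pmf)
next
  case False
  have q: "0 \<le> q" "q \<le> 1" using x pmf_le_1[of Q x] by auto
  have m: "measure_pmf.prob Q (- {x}) = 1 - q"
    using measure_pmf.prob_compl[of "{x}" Q] x by (simp add: Compl_eq_Diff_UNIV measure_pmf_single)
  have ne: "set_pmf Q \<inter> - {x} \<noteq> {}"
    using m False measure_Int_set_pmf[of Q "- {x}"] by (auto simp: Int_commute)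
  let ?M = "cond_pmf Q (- {x})"
  have "Q = bind_pmf ?M (\<lambda>w. two_point_pmf x w q)"
  proof (rule pmf_eqI)
    fix v
    have "bind_pmf ?M (\<lambda>w. two_point_pmf x w q) =
        bind_pmf (bernoulli_pmf q) (\<lambda>b. if b then return_pmf x else ?M)"
      unfolding two_point_pmf_def map_pmf_def
      by (subst bind_commute_pmf) (auto intro!: bind_pmf_cong simp: bind_return_pmf')
    then show "pmf Q v = pmf (bind_pmf ?M (\<lambda>w. two_point_pmf x w q)) v"
      using q False x m by (simp add: pmf_bind pmf_cond[OF ne] indicator_def)
  qed
  then show ?thesis using ne by (intro that[of ?M]) auto
qed

lemma exists_permutes_two:
  assumes "x0 \<in> X" "y0 \<in> X" "x \<in> X" "y \<in> X" "x0 \<noteq> y0" "x \<noteq> y"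
  shows "\<exists>\<sigma>. \<sigma> permutes X \<and> \<sigma> x0 = x \<and> \<sigma> y0 = y"
proof -
  let ?\<tau> = "Transposition.transpose x0 x"
  have "?\<tau> permutes X" using assms by (simp add: permutes_swap_id)
  moreover have "?\<tau> y0 \<in> X" "?\<tau> y0 \<noteq> x" using assms by (auto simp: Transposition.transpose_def)
  moreover have "Transposition.transpose (?\<tau> y0) y permutes X" using assms calculation by (simp add: permutes_swap_id)
  ultimately show ?thesis
    using assms by (intro exI[of _ "Transposition.transpose (?\<tau> y0) y \<circ> ?\<tau>"]) (auto intro: permutes_compose)
qed

text \<open>Random permutations sending \<open>x0\<close> to \<open>x\<close> and \<open>y0\<close>
  to a point \<open>w\<close> drawn from the rest of \<open>Q\<close> spread the two-point law out
  to \<open>Q\<close>. Collapsing all points other than \<open>x\<close> to \<open>y0\<close>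
  reverses this. So the divergence from a point mass depends only on the mass that \<open>Q\<close>
  gives to that point.\<close>

lemma sufficiency_condition_point:
  assumes D: "sufficiency_condition X D" and fin: "finite X"
    and x0: "x0 \<in> X" "y0 \<in> X" "x0 \<noteq> y0" and Q: "Q \<in> prob_simplex X" and x: "x \<in> X"
  shows "D (return_pmf x) Q = D (return_pmf x0) (two_point_pmf x0 y0 (pmf Q x))"
proof -
  obtain w0 where w0: "w0 \<in> X" "w0 \<noteq> x" using x0 by metis
  obtain M where M: "set_pmf M \<subseteq> insert w0 (set_pmf Q) - {x}"
    and QM: "Q = bind_pmf M (\<lambda>w. two_point_pmf x w (pmf Q x))"
    using pmf_decompose_at[OF refl w0(2)] by blast
  have MX: "set_pmf M \<subseteq> X - {x}" using M Q w0 by (auto simp: prob_simplex_def)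
  have "\<forall>w\<in>set_pmf M. \<exists>\<sigma>. \<sigma> permutes X \<and> \<sigma> x0 = x \<and> \<sigma> y0 = w"
    using MX x0 x by (intro ballI exists_permutes_two) auto
  then obtain \<sigma> where \<sigma>: "\<And>w. w \<in> set_pmf M \<Longrightarrow> \<sigma> w permutes X \<and> \<sigma> w x0 = x \<and> \<sigma> w y0 = w"
    by metis
  let ?T = "two_point_pmf x0 y0 (pmf Q x)"
  have "D (bind_pmf M (\<lambda>w. map_pmf (\<sigma> w) (return_pmf x0))) (bind_pmf M (\<lambda>w. map_pmf (\<sigma> w) ?T)) =
      D (return_pmf x0) ?T"
  proof (rule sufficiency_condition_bind_pmf[OF D, where f = "\<lambda>v. if v = x then x0 else y0"])
    show "finite (set_pmf M)" using MX fin finite_subset by blast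
    show "?T \<in> prob_simplex X" using x0 by (intro two_point_in_simplex)
    show "(if \<sigma> i w = x then x0 else y0) = w"
      if "i \<in> set_pmf M" "w \<in> set_pmf (return_pmf x0) \<union> set_pmf ?T" for i w
    proof -
      have "w = x0 \<or> w = y0" using that(2) set_two_point_pmf[of x0 y0 "pmf Q x"] by auto
      moreover have "i \<noteq> x" using that(1) MX by auto
      ultimately show ?thesis using \<sigma>[OF that(1)] by auto
    qed
  qed (use x0 \<sigma> in \<open>auto simp: prob_simplex_def\<close>)
  moreover have "bind_pmf M (\<lambda>w. map_pmf (\<sigma> w) (return_pmf x0)) = bind_pmf M (\<lambda>w. return_pmf x)"
    using \<sigma> by (intro bind_pmf_cong) auto
  moreover have "bind_pmf M (\<lambda>w. map_pmf (\<sigma> w) ?T) = Q"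
    by (subst (2) QM, intro bind_pmf_cong) (auto simp: map_two_point_pmf \<sigma>)
  ultimately show ?thesis by simp
qed

section \<open>Laws on three points\<close>

text \<open>The mass \<open>p\<close> is shared between \<open>x\<close> and \<open>y\<close> in the
  ratio \<open>t\<close> to \<open>1 - t\<close>. Two such laws with the same \<open>t\<close> have
  the same likelihood ratio at \<open>x\<close> and at \<open>y\<close>.\<close>

definition three_point_pmf :: "'a \<Rightarrow> 'a \<Rightarrow> 'a \<Rightarrow> real \<Rightarrow> real \<Rightarrow> 'a pmf" where
  "three_point_pmf x y w t p = bind_pmf (bernoulli_pmf t) (\<lambda>b. two_point_pmf (if b then x else y) w p)"

lemma set_three_point_pmf: "set_pmf (three_point_pmf x y w t p) \<subseteq> {x, y, w}"
  using set_two_point_pmf by (fastforce simp: three_point_pmf_def)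

lemma three_point_in_simplex:
  "x \<in> X \<Longrightarrow> y \<in> X \<Longrightarrow> w \<in> X \<Longrightarrow> three_point_pmf x y w t q \<in> prob_simplex X"
  using set_three_point_pmf[of x y w t q] by (auto simp: prob_simplex_def)

lemma pmf_three_point_pmf:
  assumes "0 \<le> t" "t \<le> 1" "0 \<le> p" "p \<le> 1"
  shows "pmf (three_point_pmf x y w t p) v =
    p * t * of_bool (v = x) + p * (1 - t) * of_bool (v = y) + (1 - p) * of_bool (v = w)"
  using assms by (simp add: three_point_pmf_def pmf_bind pmf_two_point_pmf algebra_simps)

text \<open>Splitting the mass at \<open>x\<close> is a mixture of the identity and the
  transposition of \<open>x\<close> and \<open>y\<close>, which both fix \<open>w\<close>. Sending
  everything but \<open>w\<close> back to \<open>x\<close> reverses it.\<close>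

lemma sufficiency_condition_three_point:
  assumes D: "sufficiency_condition X D"
    and X: "x \<in> X" "y \<in> X" "w \<in> X" "x \<noteq> w" "y \<noteq> w"
  shows "D (three_point_pmf x y w t p) (three_point_pmf x y w t q) =
    D (two_point_pmf x w p) (two_point_pmf x w q)"
proof -
  define \<sigma> where "\<sigma> = (\<lambda>b. if b then id else Transposition.transpose x y)"
  have three: "three_point_pmf x y w t r = bind_pmf (bernoulli_pmf t) (\<lambda>b. map_pmf (\<sigma> b) (two_point_pmf x w r))" for r
    unfolding three_point_pmf_def using X
    by (intro bind_pmf_cong) (auto simp: \<sigma>_def map_two_point_pmf Transposition.transpose_def)
  have "set_pmf (two_point_pmf x w p) \<union> set_pmf (two_point_pmf x w q) \<subseteq> {x, w}"
    using set_two_point_pmf[of x w] by simp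
  then show ?thesis
    unfolding three using X
    by (intro sufficiency_condition_bind_pmf[OF D, where f = "\<lambda>v. if v = w then w else x"])
      (auto simp: \<sigma>_def prob_simplex_def permutes_id permutes_swap_id Transposition.transpose_def)
qed

section \<open>The functional equation\<close>

text \<open>With \<open>E = h - \<lambda> ln\<close>, halving (\<open>t = 1/2\<close>) gives \<open>E (q/2) = E q\<close>, so \<open>E\<close> is bounded. A pair
  \<open>(q, p)\<close> that nearly attains the oscillation \<open>S\<close> of \<open>E\<close> makes \<open>(qt, pt)\<close> nearly attain it for every
  \<open>t\<close>; chaining \<open>(q\<^sup>2, pq)\<close> and \<open>(pq, p\<^sup>2)\<close> gives nearly \<open>2 S \<le> S\<close>.\<close>

lemma bounded_solution_is_log:
  fixes h :: "real \<Rightarrow> real"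
  assumes h1: "h 1 = 0"
    and eq: "\<And>p q t. 0 < p \<Longrightarrow> p \<le> 1 \<Longrightarrow> 0 < q \<Longrightarrow> q \<le> 1 \<Longrightarrow> 0 < t \<Longrightarrow> t < 1 \<Longrightarrow>
      h q - h p = t * (h (q * t) - h (p * t)) + (1 - t) * (h (q * (1 - t)) - h (p * (1 - t)))"
    and bnd: "\<And>q. 1/2 \<le> q \<Longrightarrow> q \<le> 1 \<Longrightarrow> \<bar>h q\<bar> \<le> B"
    and q: "0 < q" "q \<le> 1"
  shows "h q = h (1/2) / ln (1/2) * ln q"
proof -
  define l where "l = h (1/2) / ln (1/2)"
  define E where "E q = h q - l * ln q" for q
  have E1: "E 1 = 0" by (simp add: E_def h1)
  have eqE: "E q - E p = t * (E (q * t) - E (p * t)) + (1 - t) * (E (q * (1 - t)) - E (p * (1 - t)))"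
    if "0 < p" "p \<le> 1" "0 < q" "q \<le> 1" "0 < t" "t < 1" for p q t
  proof -
    have "ln (q * t) - ln (p * t) = ln q - ln p" "ln (q * (1 - t)) - ln (p * (1 - t)) = ln q - ln p"
      using that by (simp_all add: ln_mult)
    then have E: "E (q * t) - E (p * t) = h (q * t) - h (p * t) - l * (ln q - ln p)"
      "E (q * (1 - t)) - E (p * (1 - t)) = h (q * (1 - t)) - h (p * (1 - t)) - l * (ln q - ln p)"
      unfolding E_def by (smt (verit) right_diff_distrib)+
    show ?thesis unfolding E using eq[OF that] by (simp add: E_def algebra_simps)
  qed
  have half: "E (q / 2) = E q" if "0 < q" "q \<le> 1" for q
  proof -
    have "E (1/2) = 0" by (simp add: E_def l_def)
    then show ?thesis using eqE[of 1 q "1/2"] that E1 by simp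
  qed
  \<comment> \<open>Repeated doubling moves every argument into the interval on which
    \<open>h\<close> is bounded.\<close>
  have reduce: "\<exists>r\<in>{1/2..1}. E r = E q" if "0 < q" "q \<le> 1" for q
  proof -
    obtain n where "(1/2) ^ n < q" using real_arch_pow_inv[of q "1/2"] \<open>0 < q\<close> by auto
    then show ?thesis using \<open>q \<le> 1\<close>
    proof (induction n arbitrary: q)
      case (Suc n)
      show ?case
      proof (cases "q < 1/2")
        case True
        have "0 < (1/2::real) ^ Suc n" by simp
        then have "0 < q" using Suc.prems by linarith
        then show ?thesis using Suc.IH[of "2 * q"] Suc.prems True half[of "2 * q"] by auto
      qed (use Suc in auto)
    qed simp
  qed
  define T where "T = (\<lambda>(q, p). E q - E p) ` ({0<..1} \<times> {0<..1})"
  define S where "S = Sup T"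
  have "\<bar>E q\<bar> \<le> B + \<bar>l * ln (1/2)\<bar>" if q: "0 < q" "q \<le> 1" for q
  proof -
    obtain r where r: "1/2 \<le> r" "r \<le> 1" "E r = E q" using reduce[OF q] by auto
    have "ln (1/2) \<le> ln r" "ln r \<le> 0" using r by (auto simp del: ln_div)
    then have "\<bar>ln r\<bar> \<le> \<bar>ln (1/2)\<bar>" by linarith
    then have "\<bar>l * ln r\<bar> \<le> \<bar>l * ln (1/2)\<bar>" unfolding abs_mult by (intro mult_left_mono) auto
    then show ?thesis using bnd[of r] r by (simp add: E_def)
  qed
  then have "E q - E p \<le> 2 * (B + \<bar>l * ln (1/2)\<bar>)" if "0 < q" "q \<le> 1" "0 < p" "p \<le> 1" for q p
    using that abs_le_D1 abs_le_D2 by (smt (verit))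
  then have bdd: "bdd_above T" unfolding T_def by (intro bdd_aboveI[of _ "2 * (B + \<bar>l * ln (1/2)\<bar>)"]) auto
  have le: "E q - E p \<le> S" if "0 < q" "q \<le> 1" "0 < p" "p \<le> 1" for q p
    unfolding S_def using that by (intro cSup_upper[OF _ bdd]) (auto simp: T_def)
  have "S \<le> 0"
  proof (rule ccontr)
    assume "\<not> S \<le> 0"
    then have "S - S / 16 < Sup T" by (simp add: S_def)
    moreover have "T \<noteq> {}" by (auto simp: T_def)
    ultimately obtain z where "z \<in> T" "S - S / 16 < z"
      using less_cSupD by blast
    then obtain q p where qp: "0 < q" "q \<le> 1" "0 < p" "p \<le> 1" "S - S / 16 < E q - E p"
      by (auto simp: T_def)
    obtain q' p' where q': "1/2 \<le> q'" "q' \<le> 1" and p': "1/2 \<le> p'" "p' \<le> 1"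
      and qp': "S - S / 16 < E q' - E p'"
      using reduce[of q] reduce[of p] qp by auto
    \<comment> \<open>The term with \<open>1 - t\<close> contributes at most
      \<open>(1 - t) * S\<close>, so the whole defect \<open>S / 16\<close> falls on the term with
      weight \<open>t\<close>. Since \<open>t\<close> is at least 1/4, the defect there is at most
      \<open>S / 4\<close>.\<close>
    have near: "S - S / 4 \<le> E (q' * t) - E (p' * t)" if t: "1/4 \<le> t" "t \<le> 1/2" for t
    proof -
      have "E (q' * (1 - t)) - E (p' * (1 - t)) \<le> S"
        using q' p' t by (intro le) (auto intro!: mult_le_one)
      then have "(1 - t) * (E (q' * (1 - t)) - E (p' * (1 - t))) \<le> (1 - t) * S"
        using t by (intro mult_left_mono) auto
      then have "t * S - S / 16 \<le> t * (E (q' * t) - E (p' * t))"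
        using eqE[of p' q' t] q' p' t qp' by (simp add: algebra_simps)
      moreover have "1/4 * S \<le> t * S"
        using t \<open>\<not> S \<le> 0\<close> by (intro mult_right_mono) auto
      then have "t * (S - S / 4) \<le> t * S - S / 16" by (simp add: algebra_simps)
      ultimately have "t * (S - S / 4) \<le> t * (E (q' * t) - E (p' * t))" by linarith
      then show ?thesis using t by (simp add: mult_le_cancel_left_pos)
    qed
    \<comment> \<open>Halving puts the factors \<open>q' / 2\<close> and \<open>p' / 2\<close> into
      the range of \<open>near\<close>. The mixed terms cancel in the sum, which leaves 3/2 of
      \<open>S\<close> bounded by \<open>S\<close>.\<close>
    have "S - S / 4 \<le> E (q' * (q' / 2)) - E (p' * (q' / 2))"
      and "S - S / 4 \<le> E (q' * (p' / 2)) - E (p' * (p' / 2))"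
      by (rule near; use q' p' in simp)+
    moreover have "E (q' * (q' / 2)) - E (p' * (p' / 2)) \<le> S"
      using q' p' mult_le_one[of q' q'] mult_le_one[of p' p'] by (intro le) simp_all
    ultimately show False using \<open>\<not> S \<le> 0\<close> by (simp add: mult.commute)
  qed
  then have "E q = 0" using le[of q 1] le[of 1 q] q E1 by simp
  then show ?thesis by (simp add: E_def l_def)
qed

section \<open>Optimal portfolios\<close>

lemma portfolio_axis: "portfolio (axis i 1)"
  by (auto simp: portfolio_def axis_def)

lemma portfolio_uniform: "portfolio (\<chi> i. 1 / real CARD('m) :: real ^ 'm::finite)"
  by (auto simp: portfolio_def)

lemma portfolio_midpoint:
  assumes "portfolio b" "portfolio b'"
  shows "portfolio ((1/2) *\<^sub>R (b + b'))"
  using assms by (auto simp: portfolio_def sum.distrib simp flip: sum_divide_distrib)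

lemma compact_portfolios: "compact {b :: real ^ 'm::finite. portfolio b}"
proof -
  have "closed {b :: real ^ 'm. (\<forall>i. 0 \<le> b $ i) \<and> (\<Sum>i\<in>UNIV. b $ i) = 1}"
    by (intro closed_Collect_conj closed_Collect_all closed_Collect_le closed_Collect_eq continuous_intros)
  moreover have "bounded {b :: real ^ 'm. (\<forall>i. 0 \<le> b $ i) \<and> (\<Sum>i\<in>UNIV. b $ i) = 1}"
  proof (rule boundedI[of _ 1], clarify)
    fix b :: "real ^ 'm"
    assume b: "\<forall>i. 0 \<le> b $ i" "(\<Sum>i\<in>UNIV. b $ i) = 1"
    have "norm b \<le> (\<Sum>i\<in>UNIV. \<bar>b $ i\<bar>)" by (rule norm_le_l1_cart)
    then show "norm b \<le> 1" using b by simp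
  qed
  ultimately show ?thesis by (simp add: portfolio_def compact_eq_bounded_closed)
qed

section \<open>Growth rates and existence of optimal portfolios\<close>

locale market =
  fixes X :: "(real ^ 'm::finite) set"
  assumes fin: "finite X"
    and nonneg: "x \<in> X \<Longrightarrow> 0 \<le> x $ i"
    and nonzero: "x \<in> X \<Longrightarrow> \<exists>i. 0 < x $ i"
begin

abbreviation "uniform_portfolio \<equiv> (\<chi> i. 1 / real CARD('m)) :: real ^ 'm"

lemma return_nonneg: "x \<in> X \<Longrightarrow> portfolio b \<Longrightarrow> 0 \<le> x \<bullet> b"
  using nonneg by (auto simp: inner_vec_def portfolio_def intro!: sum_nonneg mult_nonneg_nonneg)

lemma return_uniform_pos:
  assumes "x \<in> X" shows "0 < x \<bullet> uniform_portfolio"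
proof -
  obtain i where "0 < x $ i" using nonzero[OF assms] by blast
  then have "0 < (\<Sum>i\<in>UNIV. x $ i)"
    using nonneg[OF assms] by (intro sum_pos2[of UNIV i]) auto
  then show ?thesis by (simp add: inner_vec_def flip: sum_divide_distrib)
qed

text \<open>A real-valued version of the growth rate. It is meaningful only if all returns on the
  support of \<open>P\<close> are positive, since \<open>ln\<close> does not take the value minus
  infinity at 0.\<close>

definition log_growth :: "real ^ 'm \<Rightarrow> (real ^ 'm) pmf \<Rightarrow> real" where
  "log_growth b P = (\<Sum>x\<in>X. pmf P x * ln (x \<bullet> b))"

lemma growth_rate_eq:
  assumes "\<And>x. x \<in> set_pmf P \<Longrightarrow> 0 < x \<bullet> b"
  shows "growth_rate X b P = ereal (log_growth b P)"
proof -
  have "ereal (pmf P x) * elog (x \<bullet> b) = ereal (pmf P x * ln (x \<bullet> b))" for x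
    using assms[of x] by (cases "x \<in> set_pmf P") (auto simp: elog_def pmf_eq_0_set_pmf)
  then show ?thesis by (simp add: growth_rate_def log_growth_def)
qed

text \<open>The term at \<open>x\<close> is minus infinity, and no other term is plus infinity to
  interfere with it.\<close>

lemma growth_rate_MInf:
  assumes "x \<in> set_pmf P" "x \<in> X" "x \<bullet> b = 0"
  shows "growth_rate X b P = - \<infinity>"
proof -
  let ?f = "\<lambda>x. ereal (pmf P x) * elog (x \<bullet> b)"
  have "?f x = - \<infinity>"
    using assms pmf_positive[OF assms(1)] by (simp add: elog_def)
  moreover have "sum ?f (X - {x}) \<noteq> \<infinity>"
  proof -
    have "?f y \<noteq> \<infinity>" for y
      by (cases "pmf P y = 0") (auto simp: elog_def pmf_nonneg less_le)
    then show ?thesis using fin by (subst sum_Pinfty) auto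
  qed
  ultimately show ?thesis
    using fin assms(2) by (simp add: growth_rate_def sum.remove)
qed

text \<open>The exponential of the growth rate is a product of powers of returns. It is continuous
  even where a return vanishes, so it attains its maximum on the compact set of portfolios.\<close>

lemma optimal_exists:
  assumes P: "P \<in> prob_simplex X"
  shows "\<exists>b. optimal_portfolio X P b"
proof -
  let ?S = "set_pmf P"
  have S: "?S \<subseteq> X" "finite ?S"
    using P fin finite_subset by (auto simp: prob_simplex_def)
  define f where "f b = (\<Prod>x\<in>?S. (x \<bullet> b) powr pmf P x)" for b
  have "continuous_on {b. portfolio b} f"
    unfolding f_def using S
    by (intro continuous_on_prod continuous_on_powr' continuous_intros)
      (auto simp: pmf_positive intro: return_nonneg)
  then obtain b where b: "portfolio b" and max: "\<And>b'. portfolio b' \<Longrightarrow> f b' \<le> f b"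
    using continuous_attains_sup[OF compact_portfolios, of f] portfolio_uniform by blast
  \<comment> \<open>The uniform portfolio has a positive return on every outcome, so the maximum is
    positive and no return of the maximizer on the support vanishes.\<close>
  have "0 < f uniform_portfolio"
    unfolding f_def using S return_uniform_pos by (intro prod_pos) (metis less_irrefl powr_gt_zero subsetD)
  then have fb: "0 < f b" using max[OF portfolio_uniform] by linarith
  have bpos: "0 < x \<bullet> b" if "x \<in> ?S" for x
  proof (rule ccontr)
    assume "\<not> 0 < x \<bullet> b"
    then have "x \<bullet> b = 0" using that S return_nonneg[OF _ b, of x] by auto
    then have "f b = 0" unfolding f_def using that S by (intro prod_zero) auto
    then show False using fb by simp
  qed
  have lnf: "ln (f b) = log_growth b P" if "\<And>x. x \<in> ?S \<Longrightarrow> 0 < x \<bullet> b" for b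
  proof -
    have "ln (f b) = (\<Sum>x\<in>?S. pmf P x * ln (x \<bullet> b))"
      unfolding f_def using less_imp_neq[OF that] S
      by (subst ln_prod) (auto simp: ln_powr intro!: sum.cong)
    also have "\<dots> = log_growth b P"
      unfolding log_growth_def using S fin
      by (intro sum.mono_neutral_left) (auto simp: pmf_eq_0_set_pmf)
    finally show ?thesis .
  qed
  have "growth_rate X b' P \<le> growth_rate X b P" if b': "portfolio b'" for b'
  proof (cases "\<forall>x\<in>?S. 0 < x \<bullet> b'")
    case True
    then have "0 < f b'" unfolding f_def by (auto intro!: prod_pos)
    then have "ln (f b') \<le> ln (f b)" using max[OF b'] by simp
    then show ?thesis using True bpos by (simp add: growth_rate_eq lnf)
  next
    case False
    then obtain x where "x \<in> ?S" "x \<bullet> b' = 0" using return_nonneg[OF _ b'] S by force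
    then show ?thesis using growth_rate_MInf[of x P b'] S by auto
  qed
  then show ?thesis using b by (auto simp: optimal_portfolio_def)
qed

lemma optimal_pos:
  assumes P: "P \<in> prob_simplex X" and b: "optimal_portfolio X P b" and x: "x \<in> set_pmf P"
  shows "0 < x \<bullet> b"
proof (rule ccontr)
  have S: "set_pmf P \<subseteq> X" using P by (auto simp: prob_simplex_def)
  assume "\<not> 0 < x \<bullet> b"
  then have "growth_rate X b P = - \<infinity>"
    using growth_rate_MInf[OF x] S x return_nonneg[of x b] b
    by (force simp: optimal_portfolio_def)
  moreover have "growth_rate X uniform_portfolio P = ereal (log_growth uniform_portfolio P)"
    using S return_uniform_pos by (intro growth_rate_eq) auto
  moreover have "growth_rate X uniform_portfolio P \<le> growth_rate X b P"
    using b portfolio_uniform by (auto simp: optimal_portfolio_def)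
  ultimately show False by simp
qed

lemma log_growth_le_optimal:
  assumes P: "P \<in> prob_simplex X" and b: "optimal_portfolio X P b"
    and b': "portfolio b'" "\<And>x. x \<in> set_pmf P \<Longrightarrow> 0 < x \<bullet> b'"
  shows "log_growth b' P \<le> log_growth b P"
proof -
  have "growth_rate X b' P \<le> growth_rate X b P" using b b' by (auto simp: optimal_portfolio_def)
  then show ?thesis using growth_rate_eq[of P b'] growth_rate_eq[of P b] b' optimal_pos[OF P b] by simp
qed

text \<open>Uniqueness comes from strict concavity of the logarithm, applied to the midpoint.\<close>

lemma optimal_return_unique:
  assumes P: "P \<in> prob_simplex X" and b: "optimal_portfolio X P b" "optimal_portfolio X P b'"
    and x: "x \<in> set_pmf P"
  shows "x \<bullet> b = x \<bullet> b'"
proof (rule ccontr)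
  assume ne: "x \<bullet> b \<noteq> x \<bullet> b'"
  define m where "m = (1/2) *\<^sub>R (b + b')"
  have S: "set_pmf P \<subseteq> X" using P by (auto simp: prob_simplex_def)
  note pos = optimal_pos[OF P b(1)] optimal_pos[OF P b(2)]
  have avg: "(ln u + ln v) / 2 \<le> ln ((u + v) / 2)" "u \<noteq> v \<Longrightarrow> (ln u + ln v) / 2 < ln ((u + v) / 2)"
    if "0 < u" "0 < v" for u v :: real
  proof -
    \<comment> \<open>The mean of the logarithms is the logarithm of the geometric mean, so
      concavity reduces to the inequality of the arithmetic and geometric means.\<close>
    have e: "(ln u + ln v) / 2 = ln (sqrt (u * v))"
      using that by (simp add: ln_sqrt ln_mult)
    show "(ln u + ln v) / 2 \<le> ln ((u + v) / 2)"
      unfolding e using that arith_geo_mean_sqrt[of u v] by (subst ln_le_cancel_iff) auto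
    assume "u \<noteq> v"
    then have "0 < (u - v)\<^sup>2" by simp
    then have "u * v < ((u + v) / 2)\<^sup>2" by (simp add: power2_eq_square algebra_simps)
    then have "sqrt (u * v) < (u + v) / 2" using that by (intro real_less_lsqrt) auto
    then show "(ln u + ln v) / 2 < ln ((u + v) / 2)"
      unfolding e using that by (subst ln_less_cancel_iff) auto
  qed
  have ret: "y \<bullet> m = (y \<bullet> b + y \<bullet> b') / 2" for y by (simp add: m_def inner_add_right)
  have lt: "(\<Sum>y\<in>X. pmf P y * ((ln (y \<bullet> b) + ln (y \<bullet> b')) / 2)) < log_growth m P"
    unfolding log_growth_def
  proof (rule sum_strict_mono_ex1[OF fin])
    show "\<forall>y\<in>X. pmf P y * ((ln (y \<bullet> b) + ln (y \<bullet> b')) / 2) \<le> pmf P y * ln (y \<bullet> m)"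
    proof
      fix y
      show "pmf P y * ((ln (y \<bullet> b) + ln (y \<bullet> b')) / 2) \<le> pmf P y * ln (y \<bullet> m)"
        unfolding ret using avg(1) pos by (cases "y \<in> set_pmf P") (auto simp: set_pmf_iff intro!: mult_left_mono)
    qed
    show "\<exists>y\<in>X. pmf P y * ((ln (y \<bullet> b) + ln (y \<bullet> b')) / 2) < pmf P y * ln (y \<bullet> m)"
      unfolding ret using x S ne avg(2) pos
      by (intro bexI[of _ x] mult_strict_left_mono) (auto simp: pmf_positive)
  qed
  have mid: "(\<Sum>y\<in>X. pmf P y * ((ln (y \<bullet> b) + ln (y \<bullet> b')) / 2)) = (log_growth b P + log_growth b' P) / 2"
    unfolding log_growth_def by (simp add: sum.distrib[symmetric] sum_divide_distrib algebra_simps add_divide_distrib)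
  have "log_growth m P \<le> log_growth b P" "log_growth m P \<le> log_growth b' P"
    using b pos portfolio_midpoint[of b b']
    by (auto intro!: log_growth_le_optimal[OF P] add_pos_pos simp: ret optimal_portfolio_def simp flip: m_def)
  then have "log_growth m P + log_growth m P \<le> log_growth b P + log_growth b' P" by (rule add_mono)
  with lt[unfolded mid] show False by simp
qed

lemma max_growth_rate_eq:
  assumes P: "P \<in> prob_simplex X" and b: "optimal_portfolio X P b"
  shows "max_growth_rate X P = ereal (log_growth b P)"
proof -
  have "max_growth_rate X P = growth_rate X b P"
    unfolding max_growth_rate_def using b
    by (intro antisym SUP_least SUP_upper) (auto simp: optimal_portfolio_def)
  then show ?thesis using optimal_pos[OF P b] by (simp add: growth_rate_eq)
qed

text \<open>All optimal portfolios for \<open>Q\<close> have the same returns on the support of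
  \<open>Q\<close>, hence on that of \<open>P\<close>, so the infimum runs over a constant.\<close>

lemma regret_eq:
  assumes P: "P \<in> prob_simplex X" and Q: "Q \<in> prob_simplex X" and PQ: "set_pmf P \<subseteq> set_pmf Q"
    and b: "optimal_portfolio X P b" and b': "optimal_portfolio X Q b'"
  shows "regret X P Q = ereal (log_growth b P - log_growth b' P)"
proof -
  have "growth_rate X b'' P = ereal (log_growth b' P)" if "optimal_portfolio X Q b''" for b''
  proof -
    have "growth_rate X b'' P = ereal (log_growth b'' P)"
      using optimal_pos[OF Q that] PQ by (intro growth_rate_eq) auto
    also have "log_growth b'' P = log_growth b' P"
      unfolding log_growth_def
      using optimal_return_unique[OF Q that b'] PQ
      by (intro sum.cong refl) (metis mult_zero_left pmf_eq_0_set_pmf subsetD)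
    finally show ?thesis .
  qed
  then have "regret X P Q = (INF b''\<in>{b. optimal_portfolio X Q b}. ereal (log_growth b P - log_growth b' P))"
    unfolding regret_def
    by (intro INF_cong) (auto simp: max_growth_rate_eq[OF P b])
  also have "\<dots> = ereal (log_growth b P - log_growth b' P)"
    using b' by (intro cINF_const) auto
  finally show ?thesis .
qed

end

section \<open>Optimal returns under the sufficiency condition\<close>

context market
begin

text \<open>Returns are linear in the portfolio, so this is also the largest return of any portfolio
  on \<open>x\<close>. It normalizes returns to relative returns in [0, 1].\<close>

definition top_return :: "real ^ 'm \<Rightarrow> real" where
  "top_return x = Max (range (\<lambda>i. x $ i))"

lemma top_return_ge: "x $ i \<le> top_return x"
  unfolding top_return_def by (intro Max_ge) auto

lemma top_return_attained: "\<exists>i. x $ i = top_return x"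
proof -
  have "top_return x \<in> range (\<lambda>i. x $ i)" unfolding top_return_def by (intro Max_in) auto
  then show ?thesis by auto
qed

lemma top_return_pos: "x \<in> X \<Longrightarrow> 0 < top_return x"
  using nonzero[of x] top_return_ge[of x] by (meson less_le_trans)

lemma return_le_top:
  assumes "portfolio b" shows "x \<bullet> b \<le> top_return x"
proof -
  have "x \<bullet> b \<le> (\<Sum>i\<in>UNIV. top_return x * b $ i)"
    using assms top_return_ge[of x]
    by (auto simp: inner_vec_def portfolio_def intro!: sum_mono mult_right_mono)
  also have "\<dots> = top_return x" using assms by (simp add: portfolio_def flip: sum_distrib_left)
  finally show ?thesis .
qed

lemma return_pmf_in_simplex: "x \<in> X \<Longrightarrow> return_pmf x \<in> prob_simplex X"
  by (simp add: prob_simplex_def)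

lemma log_growth_return: "x \<in> X \<Longrightarrow> log_growth b (return_pmf x) = ln (x \<bullet> b)"
proof -
  assume x: "x \<in> X"
  have "log_growth b (return_pmf x) = (\<Sum>y\<in>{x}. pmf (return_pmf x) y * ln (y \<bullet> b))"
    unfolding log_growth_def using x fin by (intro sum.mono_neutral_right) auto
  then show ?thesis by simp
qed

lemma optimal_return_pmf:
  assumes x: "x \<in> X" and b: "optimal_portfolio X (return_pmf x) b"
  shows "x \<bullet> b = top_return x"
proof (rule antisym)
  show "x \<bullet> b \<le> top_return x" using b by (intro return_le_top) (simp add: optimal_portfolio_def)
  obtain i where i: "x $ i = top_return x" using top_return_attained by blast
  have "log_growth (axis i 1) (return_pmf x) \<le> log_growth b (return_pmf x)"
    using i top_return_pos[OF x]
    by (intro log_growth_le_optimal[OF return_pmf_in_simplex[OF x] b] portfolio_axis)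
      (auto simp: inner_axis)
  then show "top_return x \<le> x \<bullet> b"
    using i top_return_pos[OF x] optimal_pos[OF return_pmf_in_simplex[OF x] b, of x] x
    by (simp add: log_growth_return inner_axis)
qed

lemma regret_return_pmf:
  assumes Q: "Q \<in> prob_simplex X" and x: "x \<in> set_pmf Q" and b: "optimal_portfolio X Q b"
  shows "regret X (return_pmf x) Q = ereal (ln (top_return x) - ln (x \<bullet> b))"
proof -
  have xX: "x \<in> X" using Q x by (auto simp: prob_simplex_def)
  obtain b' where b': "optimal_portfolio X (return_pmf x) b'"
    using optimal_exists[OF return_pmf_in_simplex[OF xX]] by blast
  show ?thesis
    using regret_eq[OF return_pmf_in_simplex[OF xX] Q _ b' b] x optimal_return_pmf[OF xX b']
    by (simp add: log_growth_return[OF xX])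
qed

end

locale sufficient_market = market X for X :: "(real ^ 'm::finite) set" +
  assumes card: "3 \<le> card X"
    and suff: "sufficiency_condition X (regret X)"
begin

lemma three_distinct:
  obtains x y w where "x \<in> X" "y \<in> X" "w \<in> X" "x \<noteq> y" "x \<noteq> w" "y \<noteq> w"
proof -
  obtain T where T: "T \<subseteq> X" "card T = 3" using card by (rule obtain_subset_with_card_n)
  from T(2) obtain x y w where "T = {x, y, w}" "x \<noteq> y" "y \<noteq> w" "x \<noteq> w"
    unfolding card_3_iff by blast
  then show thesis using T(1) by (intro that[of x y w]) auto
qed

text \<open>Merging all points other than \<open>x\<close> is reversible on the pair of the point mass at \<open>x\<close>
  and \<open>Q\<close>.\<close>

lemma optimal_return_local:
  obtains h where "\<And>Q b x. Q \<in> prob_simplex X \<Longrightarrow> optimal_portfolio X Q b \<Longrightarrow> x \<in> set_pmf Q \<Longrightarrow>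
    ln (x \<bullet> b) = ln (top_return x) - h (pmf Q x)"
proof -
  obtain x0 y0 where x0: "x0 \<in> X" "y0 \<in> X" "x0 \<noteq> y0" using three_distinct by metis
  show thesis
  \<comment> \<open>\<open>h\<close> is the regret at a point mass, read off from one fixed pair of
    outcomes.\<close>
  proof (rule that[of "\<lambda>q. real_of_ereal (regret X (return_pmf x0) (two_point_pmf x0 y0 q))"])
    fix Q b x
    assume Q: "Q \<in> prob_simplex X" and b: "optimal_portfolio X Q b" and x: "x \<in> set_pmf Q"
    then have "x \<in> X" by (auto simp: prob_simplex_def)
    then show "ln (x \<bullet> b) = ln (top_return x) -
        real_of_ereal (regret X (return_pmf x0) (two_point_pmf x0 y0 (pmf Q x)))"
      using sufficiency_condition_point[OF suff fin x0 Q] regret_return_pmf[OF Q x b] by simp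
  qed
qed

text \<open>The regret becomes a sum in \<open>h\<close> alone, and comparing three outcomes with
  two gives the functional equation. Top returns give \<open>h\<close> its sign and competition with
  the uniform portfolio bounds it, so \<open>h\<close> is a multiple of the logarithm.\<close>

lemma optimal_return_power:
  obtains c where "0 \<le> c"
    and "\<And>Q b x. Q \<in> prob_simplex X \<Longrightarrow> optimal_portfolio X Q b \<Longrightarrow> x \<in> set_pmf Q \<Longrightarrow>
      ln (x \<bullet> b) = ln (top_return x) + c * ln (pmf Q x)"
proof -
  obtain h where h: "\<And>Q b x. Q \<in> prob_simplex X \<Longrightarrow> optimal_portfolio X Q b \<Longrightarrow> x \<in> set_pmf Q \<Longrightarrow>
    ln (x \<bullet> b) = ln (top_return x) - h (pmf Q x)"
    using optimal_return_local by blast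
  obtain x y w where X: "x \<in> X" "y \<in> X" "w \<in> X" and ne: "x \<noteq> y" "x \<noteq> w" "y \<noteq> w"
    using three_distinct by metis
  have growth: "log_growth b P = (\<Sum>x\<in>X. pmf P x * (ln (top_return x) - h (pmf Q x)))"
    if "Q \<in> prob_simplex X" "optimal_portfolio X Q b" "set_pmf P \<subseteq> set_pmf Q" for P Q b
    unfolding log_growth_def
    using h[OF that(1,2)] that(3) by (intro sum.cong refl) (metis mult_zero_left pmf_eq_0_set_pmf subsetD)
  \<comment> \<open>Both growth rates contain the same affine term in
    \<open>ln (top_return x)\<close>, which cancels.\<close>
  have reg: "regret X P Q = ereal (\<Sum>x\<in>X. pmf P x * (h (pmf Q x) - h (pmf P x)))"
    if P: "P \<in> prob_simplex X" and Q: "Q \<in> prob_simplex X" and PQ: "set_pmf P \<subseteq> set_pmf Q" for P Q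
  proof -
    obtain b b' where b: "optimal_portfolio X P b" "optimal_portfolio X Q b'"
      using optimal_exists P Q by blast
    show ?thesis
      using regret_eq[OF P Q PQ b] growth[OF P b(1)] growth[OF Q b(2) PQ]
      by (simp add: sum_subtractf[symmetric] right_diff_distrib)
  qed
  have h1: "h 1 = 0"
  proof -
    obtain b where "optimal_portfolio X (return_pmf x) b"
      using optimal_exists[OF return_pmf_in_simplex[OF X(1)]] by blast
    then show ?thesis
      using h[of "return_pmf x" b x] optimal_return_pmf[of x b] X return_pmf_in_simplex by simp
  qed
  have hpos: "0 \<le> h q" if q: "0 < q" "q < 1" for q
  proof -
    let ?Q = "two_point_pmf x y q"
    obtain b where b: "optimal_portfolio X ?Q b"
      using optimal_exists[OF two_point_in_simplex] X by blast
    have "pmf ?Q x = q" using q ne by (simp add: pmf_two_point_pmf)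
    moreover have "x \<in> set_pmf ?Q" using q ne by (simp add: set_pmf_iff pmf_two_point_pmf)
    moreover have "x \<bullet> b \<le> top_return x" using b by (intro return_le_top) (simp add: optimal_portfolio_def)
    moreover have "0 < x \<bullet> b" using optimal_pos[OF two_point_in_simplex b] X calculation by blast
    ultimately show ?thesis
      using h[OF two_point_in_simplex b, of x] X top_return_pos[of x]
      by (smt (verit) ln_le_cancel_iff)
  qed
  \<comment> \<open>\<open>K v\<close> bounds the logarithmic loss of the uniform portfolio against
    the best asset on \<open>v\<close>.\<close>
  define K where "K v = \<bar>ln (top_return v) - ln (v \<bullet> uniform_portfolio)\<bar>" for v
  have hbound: "q * h q \<le> K x + K y" if q: "0 < q" "q < 1" for q
  proof -
    let ?Q = "two_point_pmf x y q"
    have S: "?Q \<in> prob_simplex X" using X by (intro two_point_in_simplex)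
    obtain b where b: "optimal_portfolio X ?Q b" using optimal_exists[OF S] by blast
    have two: "(\<Sum>v\<in>X. pmf ?Q v * f v) = q * f x + (1 - q) * f y" for f
      using fin X ne q by (intro sum_two_point_pmf) auto
    have "log_growth uniform_portfolio ?Q \<le> log_growth b ?Q"
      using S return_uniform_pos portfolio_uniform
      by (intro log_growth_le_optimal[OF S b]) (auto simp: prob_simplex_def)
    then have le: "q * ln (x \<bullet> uniform_portfolio) + (1 - q) * ln (y \<bullet> uniform_portfolio) \<le>
        q * (ln (top_return x) - h q) + (1 - q) * (ln (top_return y) - h (1 - q))"
      unfolding growth[OF S b order_refl] log_growth_def[of uniform_portfolio] two
      using ne q by (simp add: pmf_two_point_pmf)
    have "0 \<le> (1 - q) * h (1 - q)" using hpos[of "1 - q"] q by simp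
    moreover have "r * (ln (top_return v) - ln (v \<bullet> uniform_portfolio)) \<le> K v" if "0 < r" "r < 1" for r v
      unfolding K_def using that mult_left_le_one_le[of "\<bar>ln (top_return v) - ln (v \<bullet> uniform_portfolio)\<bar>" r]
      by (smt (verit) mult_left_mono)
    from this[of q x] this[of "1 - q" y] q
    have "q * (ln (top_return x) - ln (x \<bullet> uniform_portfolio)) \<le> K x"
      "(1 - q) * (ln (top_return y) - ln (y \<bullet> uniform_portfolio)) \<le> K y"
      by auto
    ultimately show ?thesis using le by (simp add: algebra_simps)
  qed
  have eq1: "h q - h p = t * (h (q * t) - h (p * t)) + (1 - t) * (h (q * (1 - t)) - h (p * (1 - t)))"
    if p: "0 < p" "p \<le> 1" and q: "0 < q" "q < 1" and t: "0 < t" "t < 1" for p q t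
  proof -
    let ?T = "three_point_pmf x y w t" and ?U = "two_point_pmf x w"
    have pmfT: "pmf (?T r) v = r * t * of_bool (v = x) + r * (1 - t) * of_bool (v = y) + (1 - r) * of_bool (v = w)"
      if "0 \<le> r" "r \<le> 1" for r v using that t by (intro pmf_three_point_pmf) auto
    have "set_pmf (?T p) \<subseteq> set_pmf (?T q)"
      using p q t ne by (intro order_trans[OF set_three_point_pmf]) (auto simp: set_pmf_iff pmfT)
    then have T: "regret X (?T p) (?T q) = ereal (\<Sum>v\<in>{x, y, w}. pmf (?T p) v * (h (pmf (?T q) v) - h (pmf (?T p) v)))"
      using X p q t fin
      by (subst reg) (auto intro!: three_point_in_simplex sum.mono_neutral_right simp: pmfT)
    have "set_pmf (?U p) \<subseteq> set_pmf (?U q)"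
      using p q t ne by (intro order_trans[OF set_two_point_pmf]) (auto simp: set_pmf_iff pmf_two_point_pmf)
    then have U: "regret X (?U p) (?U q) = ereal (\<Sum>v\<in>{x, w}. pmf (?U p) v * (h (pmf (?U q) v) - h (pmf (?U p) v)))"
      using X p q t fin
      by (subst reg) (auto intro!: two_point_in_simplex sum.mono_neutral_right simp: pmf_two_point_pmf)
    have "p * (t * (h (q * t) - h (p * t)) + (1 - t) * (h (q * (1 - t)) - h (p * (1 - t)))) = p * (h q - h p)"
      using sufficiency_condition_three_point[OF suff X ne(2,3), of t p q] ne p q
      unfolding T U by (simp add: pmfT pmf_two_point_pmf algebra_simps)
    then show ?thesis using p by simp
  qed
  have eq: "h q - h p = t * (h (q * t) - h (p * t)) + (1 - t) * (h (q * (1 - t)) - h (p * (1 - t)))"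
    if "0 < p" "p \<le> 1" "0 < q" "q \<le> 1" "0 < t" "t < 1" for p q t
  proof (cases "q < 1")
    case True
    then show ?thesis using that by (intro eq1)
  next
    case False
    then have "q = 1" using that by simp
    \<comment> \<open>At \<open>q = 1\<close> the support of the second law can be too small. Both
      sides change sign when \<open>p\<close> and \<open>q\<close> are exchanged, so the case with
      \<open>p < 1\<close> follows from \<open>eq1\<close> with the roles reversed.\<close>
    then show ?thesis
      using that eq1[of q p t] by (cases "p = 1") (auto simp: algebra_simps)
  qed
  \<comment> \<open>The factor 2 comes from dividing the bound on \<open>q * h q\<close> by
    \<open>q\<close>, which is at least 1/2.\<close>
  define B where "B = 2 * (K x + K y)"
  have bnd: "\<bar>h q\<bar> \<le> B" if "1/2 \<le> q" "q \<le> 1" for q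
  proof (cases "q = 1")
    case False
    then have "1/2 * h q \<le> q * h q" using that hpos[of q] by (intro mult_right_mono) auto
    then show ?thesis using hpos[of q] hbound[of q] that False by (simp add: B_def)
  qed (simp add: h1 B_def K_def)
  show thesis
  proof (rule that[of "- (h (1/2) / ln (1/2))"])
    show "0 \<le> - (h (1/2) / ln (1/2))" using hpos[of "1/2"] by (simp add: ln_div divide_nonneg_neg)
    show "ln (x \<bullet> b) = ln (top_return x) + - (h (1/2) / ln (1/2)) * ln (pmf Q x)"
      if "Q \<in> prob_simplex X" "optimal_portfolio X Q b" "x \<in> set_pmf Q" for Q b x
      using h[OF that] bounded_solution_is_log[of h B "pmf Q x", OF h1 eq bnd] pmf_positive[OF that(3)]
      by (simp add: pmf_le_1)
  qed
qed

end

section \<open>Gambling assets\<close>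

text \<open>Exponentiated, the assumption says that an optimal portfolio has relative return
  \<open>pmf Q x\<close> to the power \<open>c\<close> on \<open>x\<close>. For \<open>c = 1\<close>
  this is proportional betting.\<close>

locale log_market = market X for X :: "(real ^ 'm::finite) set" +
  fixes c :: real
  assumes optimal_return: "Q \<in> prob_simplex X \<Longrightarrow> optimal_portfolio X Q b \<Longrightarrow> x \<in> set_pmf Q \<Longrightarrow>
      ln (x \<bullet> b) = ln (top_return x) + c * ln (pmf Q x)"
    and c_pos: "0 < c"
begin

text \<open>The right-hand side is the growth rate of an optimal portfolio for
  \<open>P\<close>.\<close>

lemma log_growth_le:
  assumes P: "P \<in> prob_simplex X" and b: "portfolio b" "\<And>x. x \<in> set_pmf P \<Longrightarrow> 0 < x \<bullet> b"
  shows "log_growth b P \<le> (\<Sum>x\<in>X. pmf P x * (ln (top_return x) + c * ln (pmf P x)))"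
proof -
  obtain b' where b': "optimal_portfolio X P b'" using optimal_exists[OF P] by blast
  have "log_growth b' P = (\<Sum>x\<in>X. pmf P x * (ln (top_return x) + c * ln (pmf P x)))"
    unfolding log_growth_def
    using optimal_return[OF P b'] by (intro sum.cong refl) (metis mult_zero_left pmf_eq_0_set_pmf)
  then show ?thesis using log_growth_le_optimal[OF P b' b] by simp
qed

text \<open>Otherwise the asset would beat the maximal growth rate near the point mass at \<open>x\<close>, where the
  latter has slope \<open>-\<infinity>\<close>.\<close>

lemma top_asset_gambling:
  assumes x: "x \<in> X" "x $ i = top_return x" and y: "y \<in> X" "y \<noteq> x"
  shows "y $ i = 0"
proof (rule ccontr)
  assume "y $ i \<noteq> 0"
  then have yi: "0 < y $ i" using nonneg[OF y(1), of i] by simp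
  define K where "K = ln (y $ i) - ln (top_return y)"
  \<comment> \<open>The exponential makes \<open>c * ln e\<close> at most \<open>K - 1\<close>,
    which contradicts the bound \<open>K \<le> c * ln e\<close> to come; the minimum keeps
    \<open>e\<close> below 1.\<close>
  define e where "e = min (1/2) (exp ((K - 1) / c))"
  have e: "0 < e" "e < 1" by (auto simp: e_def)
  let ?P = "two_point_pmf x y (1 - e)"
  have P: "?P \<in> prob_simplex X" using x y by (intro two_point_in_simplex)
  have two: "(\<Sum>v\<in>X. pmf ?P v * f v) = (1 - e) * f x + e * f y" for f
    using sum_two_point_pmf[of X x y "1 - e" f] fin x y e by simp
  have "log_growth (axis i 1) ?P \<le> (\<Sum>v\<in>X. pmf ?P v * (ln (top_return v) + c * ln (pmf ?P v)))"
    using set_two_point_pmf[of x y "1 - e"] yi x top_return_pos[of x]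
    by (intro log_growth_le[OF P] portfolio_axis) (auto simp: inner_axis)
  then have "e * K \<le> (1 - e) * (c * ln (1 - e)) + e * (c * ln e)"
    unfolding log_growth_def two using x y e
    by (simp add: inner_axis pmf_two_point_pmf K_def algebra_simps)
  moreover have "(1 - e) * (c * ln (1 - e)) \<le> 0"
    using e c_pos by (intro mult_nonneg_nonpos) auto
  ultimately have "e * K \<le> e * (c * ln e)" by linarith
  then have "K \<le> c * ln e" using e by simp
  moreover have "ln e \<le> (K - 1) / c"
    using e ln_le_cancel_iff[of e "exp ((K - 1) / c)"] by (simp add: e_def)
  then have "c * ln e \<le> K - 1" using c_pos by (simp add: field_simps)
  ultimately show False by simp
qed

text \<open>Since the portfolios form a polytope, a return on \<open>y\<close> costs at least a proportional loss on
  \<open>x\<close>; returns \<open>(1 - e)\<^sup>c\<close> and \<open>e\<^sup>c\<close> violate this for small \<open>e\<close> if \<open>c < 1\<close>.\<close>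

lemma exponent_ge_1:
  assumes xy: "x \<in> X" "y \<in> X" "x \<noteq> y"
  shows "1 \<le> c"
proof (rule ccontr)
  assume "\<not> 1 \<le> c"
  then have c: "c < 1" by simp
  note tx = top_return_pos[OF xy(1)] and ty = top_return_pos[OF xy(2)]
  \<comment> \<open>\<open>\<kappa>\<close> is the least relative shortfall on \<open>x\<close>
    among assets that are not top there. The inserted 1 covers the case that there are none.\<close>
  define \<kappa> where "\<kappa> = Min (insert 1 ((\<lambda>i. 1 - x $ i / top_return x) ` {i. x $ i \<noteq> top_return x}))"
  have "0 < 1 - x $ i / top_return x" if "x $ i \<noteq> top_return x" for i
    using that top_return_ge[of x i] tx by (simp add: divide_less_eq)
  then have \<kappa>: "0 < \<kappa>" by (auto simp: \<kappa>_def)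
  have \<kappa>1: "\<kappa> \<le> 1" by (auto simp: \<kappa>_def)
  \<comment> \<open>Top assets on \<open>x\<close> return nothing on \<open>y\<close>; every other
    asset loses at least \<open>\<kappa>\<close> on \<open>x\<close> and gains at most
    \<open>\<kappa>\<close> from the first term.\<close>
  have asset: "\<kappa> * (y $ i / top_return y) + x $ i / top_return x \<le> 1" for i
  proof (cases "x $ i = top_return x")
    case True
    then show ?thesis using top_asset_gambling[of x i y] xy tx by simp
  next
    case False
    then have "\<kappa> \<le> 1 - x $ i / top_return x" unfolding \<kappa>_def by (intro Min_le) auto
    moreover have "y $ i / top_return y \<le> 1" using top_return_ge[of y i] ty by simp
    then have "\<kappa> * (y $ i / top_return y) \<le> \<kappa> * 1" using \<kappa> by (intro mult_left_mono) auto
    ultimately show ?thesis by simp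
  qed
  \<comment> \<open>Chosen so that \<open>e powr (1 - c)\<close> is \<open>\<kappa> / 2\<close>,
    while the inequality for portfolios would require at least \<open>\<kappa>\<close>.\<close>
  define e where "e = (\<kappa> / 2) powr (1 / (1 - c))"
  have e: "0 < e" "e < 1"
  proof -
    show "0 < e" using \<kappa> by (simp add: e_def)
    have "(\<kappa> / 2) powr (1 / (1 - c)) < 1 powr (1 / (1 - c))"
      using \<kappa> \<kappa>1 c by (intro powr_less_mono2) auto
    then show "e < 1" by (simp add: e_def)
  qed
  let ?P = "two_point_pmf x y (1 - e)"
  have P: "?P \<in> prob_simplex X" using xy by (intro two_point_in_simplex)
  obtain b where b: "optimal_portfolio X ?P b" using optimal_exists[OF P] by blast
  have ret: "v \<bullet> b = top_return v * pmf ?P v powr c" if v: "v \<in> set_pmf ?P" for v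
  proof -
    have "0 < top_return v" using v P top_return_pos by (auto simp: prob_simplex_def)
    moreover have "0 < pmf ?P v" using pmf_positive[OF v] .
    moreover have "0 < v \<bullet> b" using optimal_pos[OF P b v] .
    moreover have "ln (v \<bullet> b) = ln (top_return v * pmf ?P v powr c)"
      using optimal_return[OF P b v] calculation by (simp add: ln_mult ln_powr)
    ultimately show ?thesis by (simp add: ln_inj_iff)
  qed
  have pmf: "pmf ?P x = 1 - e" "pmf ?P y = e"
    using e xy by (simp_all add: pmf_two_point_pmf)
  have rx: "x \<bullet> b / top_return x = (1 - e) powr c" and ry: "y \<bullet> b / top_return y = e powr c"
    using ret[of x] ret[of y] pmf e tx ty by (simp_all add: set_pmf_iff)
  \<comment> \<open>The inequality \<open>asset\<close> is linear, so it passes to the portfolio by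
    averaging.\<close>
  have "\<kappa> * (y \<bullet> b / top_return y) + x \<bullet> b / top_return x =
      (\<Sum>i\<in>UNIV. b $ i * (\<kappa> * (y $ i / top_return y) + x $ i / top_return x))"
    by (simp add: inner_vec_def sum_divide_distrib sum_distrib_left sum.distrib[symmetric] algebra_simps)
  also have "\<dots> \<le> (\<Sum>i\<in>UNIV. b $ i * 1)"
    using b asset by (intro sum_mono mult_left_mono) (auto simp: optimal_portfolio_def portfolio_def)
  also have "\<dots> = 1" using b by (simp add: optimal_portfolio_def portfolio_def)
  finally have "\<kappa> * e powr c + (1 - e) powr c \<le> 1" unfolding rx ry .
  moreover have "1 - e \<le> (1 - e) powr c"
    using powr_mono'[of c 1 "1 - e"] c e by simp
  ultimately have "\<kappa> * e powr c \<le> e" by linarith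
  also have "e = e powr (1 - c) * e powr c" using e by (simp flip: powr_add)
  finally have "\<kappa> \<le> e powr (1 - c)" using e by simp
  also have "e powr (1 - c) = \<kappa> / 2" using c \<kappa> by (simp add: e_def powr_powr)
  finally show False using \<kappa> by simp
qed

text \<open>With sum \<open>s > 1\<close>, take for \<open>P\<close> the relative returns of the
  asset divided by \<open>s\<close>. The asset then exceeds the growth rate of proportional betting
  by \<open>ln s\<close>, while \<open>1 \<le> c\<close> keeps the maximal growth rate from
  exceeding that of proportional betting.\<close>

lemma sum_relative_return_le_1:
  assumes X: "X \<noteq> {}" and c: "1 \<le> c"
  shows "(\<Sum>x\<in>X. x $ i / top_return x) \<le> 1"
proof (rule ccontr)
  define s where "s = (\<Sum>x\<in>X. x $ i / top_return x)"
  assume "\<not> ?thesis"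
  then have s: "1 < s" by (simp add: s_def)
  define f where "f x = (if x \<in> X then x $ i / top_return x / s else 0)" for x
  have f0: "0 \<le> f x" for x
    using s nonneg[of x i] top_return_pos[of x] by (auto simp: f_def)
  have f_in: "f x = 0" if "x \<notin> X" for x using that by (simp add: f_def)
  have sumf: "(\<Sum>x\<in>X. f x) = 1"
  proof -
    have "(\<Sum>x\<in>X. f x) = s / s" unfolding s_def sum_divide_distrib by (simp add: f_def s_def)
    then show ?thesis using s by simp
  qed
  have "(\<integral>\<^sup>+x. ennreal (f x) \<partial>count_space UNIV) = (\<Sum>x\<in>X. ennreal (f x))"
    using fin f_in by (intro nn_integral_count_space'[of X]) auto
  also have "\<dots> = 1" using f0 sumf by simp
  finally have int: "(\<integral>\<^sup>+x. ennreal (f x) \<partial>count_space UNIV) = 1" .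
  define P where "P = embed_pmf f"
  have pmf: "pmf P x = f x" for x unfolding P_def using f0 int by (rule pmf_embed_pmf)
  have P: "P \<in> prob_simplex X" using f_in by (force simp: prob_simplex_def set_pmf_iff pmf)
  have pos: "0 < x $ i" if x: "x \<in> set_pmf P" for x
  proof -
    have "x \<in> X" using x P by (auto simp: prob_simplex_def)
    then show ?thesis using x nonneg[of x i] by (auto simp: set_pmf_iff pmf f_def less_le)
  qed
  have "log_growth (axis i 1) P = (\<Sum>x\<in>X. pmf P x * (ln s + ln (top_return x) + ln (pmf P x)))"
    unfolding log_growth_def
  proof (intro sum.cong refl)
    fix x assume x: "x \<in> X"
    show "pmf P x * ln (x \<bullet> axis i 1) = pmf P x * (ln s + ln (top_return x) + ln (pmf P x))"
    proof (cases "x \<in> set_pmf P")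
      case True
      then have "ln (pmf P x) = ln (x $ i) - ln (top_return x) - ln s"
        using pos[OF True] s x top_return_pos[OF x] by (simp add: pmf f_def ln_div ln_mult)
      then show ?thesis by (simp add: inner_axis)
    qed (simp add: set_pmf_iff)
  qed
  also have "\<dots> = ln s + (\<Sum>x\<in>X. pmf P x * (ln (top_return x) + ln (pmf P x)))"
    using sumf by (simp add: pmf distrib_left sum.distrib flip: sum_distrib_right)
  finally have "ln s + (\<Sum>x\<in>X. pmf P x * (ln (top_return x) + ln (pmf P x))) \<le>
      (\<Sum>x\<in>X. pmf P x * (ln (top_return x) + c * ln (pmf P x)))"
    using log_growth_le[OF P portfolio_axis, of i] pos by (simp add: inner_axis)
  also have "\<dots> \<le> (\<Sum>x\<in>X. pmf P x * (ln (top_return x) + ln (pmf P x)))"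
  proof (intro sum_mono)
    fix x
    show "pmf P x * (ln (top_return x) + c * ln (pmf P x)) \<le> pmf P x * (ln (top_return x) + ln (pmf P x))"
    proof (cases "x \<in> set_pmf P")
      case True
      \<comment> \<open>The logarithm of a probability is nonpositive, so a factor of at least 1 can
        only lower it.\<close>
      then have "ln (pmf P x) \<le> 0" using pmf_positive[OF True] by (simp add: pmf_le_1)
      then have "c * ln (pmf P x) \<le> 1 * ln (pmf P x)" using c by (intro mult_right_mono_neg)
      then show ?thesis by (intro mult_left_mono) auto
    qed (simp add: set_pmf_iff)
  qed
  finally show False using s by simp
qed

text \<open>A top asset \<open>g x\<close> for each outcome \<open>x\<close> pays on
  \<open>x\<close> only, so \<open>g\<close> is injective on \<open>X\<close>. To match asset
  \<open>i\<close> on every outcome, hold its relative return on \<open>x\<close> as the share of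
  \<open>g x\<close>; these shares sum to at most 1.\<close>

lemma gambling_assets:
  assumes card: "2 \<le> card X"
  shows "\<exists>G :: 'm set. card G = card X \<and> (\<forall>g\<in>G. gambling_asset X g) \<and>
           (\<forall>i. \<exists>b. portfolio b \<and> (\<forall>j. j \<notin> G \<longrightarrow> b $ j = 0) \<and> dominates X b (axis i 1))"
proof -
  obtain x1 x2 where x12: "x1 \<in> X" "x2 \<in> X" "x1 \<noteq> x2"
    using card fin by (metis card_le_Suc0_iff_eq not_less_eq_eq numeral_2_eq_2)
  obtain g where g: "\<And>x. x $ g x = top_return x" using top_return_attained by metis
  have zero: "y $ g x = 0" if "x \<in> X" "y \<in> X" "y \<noteq> x" for x y
    using that g by (intro top_asset_gambling)
  have "inj_on g X"
  proof (rule inj_onI, rule ccontr)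
    fix x y assume "x \<in> X" "y \<in> X" "g x = g y" "x \<noteq> y"
    then show False using zero[of x y] g[of y] top_return_pos[of y] by simp
  qed
  moreover have "gambling_asset X (g x)" if "x \<in> X" for x
    unfolding gambling_asset_def using that g top_return_pos[of x] zero[of x] by (intro ex1I[of _ x]) force+
  moreover have "\<exists>b. portfolio b \<and> (\<forall>j. j \<notin> g ` X \<longrightarrow> b $ j = 0) \<and> dominates X b (axis i 1)" for i
  proof -
    define s where "s = (\<Sum>x\<in>X. x $ i / top_return x)"
    have s: "s \<le> 1"
      unfolding s_def using x12 exponent_ge_1[OF x12] by (intro sum_relative_return_le_1) auto
    have a: "0 \<le> x $ i / top_return x" if "x \<in> X" for x
      using nonneg[OF that, of i] top_return_pos[OF that] by simp
    \<comment> \<open>The leftover share \<open>1 - s\<close> goes to an arbitrary gambling asset,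
      which cannot lower any return.\<close>
    define b :: "real ^ 'm" where
      "b = (\<Sum>x\<in>X. (x $ i / top_return x) *\<^sub>R axis (g x) 1) + (1 - s) *\<^sub>R axis (g x1) 1"
    have bj: "b $ j = (\<Sum>x\<in>X. x $ i / top_return x * of_bool (j = g x)) + (1 - s) * of_bool (j = g x1)" for j
      by (simp add: b_def axis_def of_bool_def)
    have "portfolio b"
      unfolding portfolio_def
    proof
      show "\<forall>j. 0 \<le> b $ j" unfolding bj using a s by (auto intro!: add_nonneg_nonneg sum_nonneg mult_nonneg_nonneg)
      have "(\<Sum>j\<in>UNIV. \<Sum>x\<in>X. x $ i / top_return x * of_bool (j = g x)) = s"
        by (subst sum.swap) (simp add: s_def of_bool_def if_distrib[of "(*) _"] cong: if_cong)
      then show "(\<Sum>j\<in>UNIV. b $ j) = 1"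
        unfolding bj by (simp add: sum.distrib of_bool_def if_distrib[of "(*) _"] cong: if_cong)
    qed
    moreover have "b $ j = 0" if "j \<notin> g ` X" for j
      unfolding bj using that x12(1) by (auto intro!: sum.neutral)
    moreover have "dominates X b (axis i 1)"
      unfolding dominates_def
    proof
      fix y assume y: "y \<in> X"
      have "y $ i = y $ i / top_return y * y $ g y" using g top_return_pos[OF y] by simp
      also have "\<dots> \<le> (\<Sum>x\<in>X. x $ i / top_return x * y $ g x)"
        using a y nonneg[OF y] fin by (intro member_le_sum) (auto intro!: mult_nonneg_nonneg simp del: times_divide_eq_left)
      also have "\<dots> \<le> y \<bullet> b"
        using s nonneg[OF y] by (simp add: b_def inner_add_right inner_sum_right inner_axis)
      finally show "y \<bullet> axis i 1 \<le> y \<bullet> b" by (simp add: inner_axis)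
    qed
    ultimately show ?thesis by blast
  qed
  ultimately show ?thesis by (intro exI[of _ "g ` X"]) (auto simp: card_image)
qed

end

section \<open>Markets with vanishing regret, and the conclusion\<close>

text \<open>A portfolio that attains the top return on every outcome is optimal for every law, so
  knowing the law has no value.\<close>

lemma (in market) regret_eq_0:
  assumes b: "portfolio b" "\<And>x. x \<in> X \<Longrightarrow> x \<bullet> b = top_return x"
    and P: "P \<in> prob_simplex X" and Q: "Q \<in> prob_simplex X"
  shows "regret X P Q = 0"
proof -
  have best: "growth_rate X b' R \<le> growth_rate X b R" if b': "portfolio b'" and R: "R \<in> prob_simplex X" for b' R
  proof -
    have RX: "set_pmf R \<subseteq> X" using R by (simp add: prob_simplex_def)
    have gb: "growth_rate X b R = ereal (log_growth b R)"
      using RX b(2) top_return_pos by (intro growth_rate_eq) auto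
    show ?thesis
    proof (cases "\<forall>x\<in>set_pmf R. 0 < x \<bullet> b'")
      case True
      have "log_growth b' R \<le> log_growth b R"
        unfolding log_growth_def
      proof (intro sum_mono)
        fix x assume x: "x \<in> X"
        show "pmf R x * ln (x \<bullet> b') \<le> pmf R x * ln (x \<bullet> b)"
        proof (cases "x \<in> set_pmf R")
          case R: True
          then have "ln (x \<bullet> b') \<le> ln (x \<bullet> b)"
            using True return_le_top[OF b', of x] b(2)[OF x] top_return_pos[OF x] by simp
          then show ?thesis by (intro mult_left_mono) auto
        qed (simp add: set_pmf_iff)
      qed
      then show ?thesis using True by (simp add: gb growth_rate_eq)
    next
      case False
      then obtain x where "x \<in> set_pmf R" "x \<bullet> b' = 0" using return_nonneg[OF _ b'] RX by force
      then show ?thesis using growth_rate_MInf[of x R b'] RX by auto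
    qed
  qed
  then have opt: "optimal_portfolio X R b" if "R \<in> prob_simplex X" for R
    using b that by (auto simp: optimal_portfolio_def)
  have gb: "growth_rate X b P = ereal (log_growth b P)"
    using optimal_pos[OF P opt[OF P]] by (intro growth_rate_eq) auto
  have max: "max_growth_rate X P = ereal (log_growth b P)" by (rule max_growth_rate_eq[OF P opt[OF P]])
  show ?thesis
  proof (rule antisym)
    have "regret X P Q \<le> max_growth_rate X P - growth_rate X b P"
      unfolding regret_def using opt[OF Q] by (intro INF_lower) auto
    then show "regret X P Q \<le> 0" by (simp add: max gb zero_ereal_def)
    show "0 \<le> regret X P Q"
      unfolding regret_def max
    proof (rule INF_greatest)
      fix b' assume "b' \<in> {b. optimal_portfolio X Q b}"
      then have "growth_rate X b' P \<le> ereal (log_growth b P)"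
        using best[OF _ P, of b'] gb by (simp add: optimal_portfolio_def)
      then show "0 \<le> ereal (log_growth b P) - growth_rate X b' P"
        by (cases "growth_rate X b' P") auto
    qed
  qed
qed

text \<open>The hypothesis of a nonzero regret excludes markets where one portfolio is best on every
  outcome: there the regret vanishes and the sufficiency condition holds trivially.\<close>

theorem corollary18:
  fixes X :: "(real ^ 'm::finite) set" and k :: nat
  assumes "finite X" and "card X = k" and "k \<ge> 3"
    and "\<forall>x\<in>X. \<forall>i. 0 \<le> x $ i"
    and "\<forall>P\<in>prob_simplex X. \<bar>max_growth_rate X P\<bar> \<noteq> \<infinity>"
    and "\<exists>P\<in>prob_simplex X. \<exists>Q\<in>prob_simplex X. regret X P Q \<noteq> 0"
    and "sufficiency_condition X (regret X)"
  shows "\<exists>G :: 'm set. card G = k \<and> (\<forall>g\<in>G. gambling_asset X g) \<and>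
           (\<forall>i. i \<notin> G \<longrightarrow>
              (\<exists>b. portfolio b \<and> (\<forall>j. j \<notin> G \<longrightarrow> b $ j = 0) \<and> dominates X b (axis i 1)))"
proof -
  \<comment> \<open>If the zero vector were feasible, every portfolio would have growth rate minus
    infinity at its point mass, against the finiteness of the maximal values.\<close>
  have pos: "\<exists>i. 0 < x $ i" if x: "x \<in> X" for x
  proof (rule ccontr)
    assume "\<not> ?thesis"
    then have "x $ i = 0" for i using assms(4) x by (intro antisym) (auto simp: not_less)
    then have "x = 0" by (simp add: vec_eq_iff)
    then have "growth_rate X b (return_pmf x) = (\<Sum>y\<in>X. if y = x then - \<infinity> else 0)" for b
      unfolding growth_rate_def by (intro sum.cong) (auto simp: elog_def simp flip: zero_ereal_def)
    then have "growth_rate X b (return_pmf x) = - \<infinity>" for b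
      using assms(1) x by simp
    moreover have "{b :: real ^ 'm. portfolio b} \<noteq> {}" using portfolio_axis by blast
    ultimately have "max_growth_rate X (return_pmf x) = - \<infinity>" by (simp add: max_growth_rate_def)
    then show False using bspec[OF assms(5), of "return_pmf x"] x by (simp add: prob_simplex_def)
  qed
  interpret sufficient_market X
  proof unfold_locales
    show "finite X" "\<And>x i. x \<in> X \<Longrightarrow> 0 \<le> x $ i" "3 \<le> card X" "sufficiency_condition X (regret X)"
      using assms(1,2,3,4,7) by simp_all
  qed (rule pos)
  obtain c where c: "0 \<le> c" "\<And>Q b x. Q \<in> prob_simplex X \<Longrightarrow> optimal_portfolio X Q b \<Longrightarrow> x \<in> set_pmf Q \<Longrightarrow>
      ln (x \<bullet> b) = ln (top_return x) + c * ln (pmf Q x)"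
    using optimal_return_power by blast
  have "c \<noteq> 0"
  proof
    assume "c = 0"
    have ne: "X \<noteq> {}" using card by auto
    \<comment> \<open>The uniform law has full support, so with \<open>c = 0\<close> its optimal
      portfolio attains the top return on all of \<open>X\<close>.\<close>
    let ?U = "pmf_of_set X"
    have U: "?U \<in> prob_simplex X" using fin ne by (simp add: prob_simplex_def)
    obtain b where b: "optimal_portfolio X ?U b" using optimal_exists[OF U] by blast
    have "x \<bullet> b = top_return x" if x: "x \<in> X" for x
      using c(2)[OF U b, of x] x fin ne \<open>c = 0\<close> optimal_pos[OF U b, of x] top_return_pos[OF x] by simp
    then show False
      using regret_eq_0[of b] b assms(6) by (auto simp: optimal_portfolio_def)
  qed
  then have "0 < c" using c(1) by simp
  interpret log_market X c
    by unfold_locales (rule c(2), assumption+, rule \<open>0 < c\<close>)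
  have "2 \<le> card X" using card by simp
  obtain G :: "'m set" where "card G = card X" "\<forall>g\<in>G. gambling_asset X g"
    "\<And>i. \<exists>b. portfolio b \<and> (\<forall>j. j \<notin> G \<longrightarrow> b $ j = 0) \<and> dominates X b (axis i 1)"
    using gambling_assets[OF \<open>2 \<le> card X\<close>] by blast
  then show ?thesis using assms(2) by (intro exI[of _ G]) simp
qed

end
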